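(* Let $\Gamma=(X,\ast,t,I)$ be a finite incidence system such that all elements have degree at least two and all flags have rank at most two. Then there exists a finite incidence geometry $\Gamma'=(X',\ast',t',I)$ (with the same set of types $I$) such that $(\operatorname{Aut}(\Gamma'),\operatorname{Aut}_I(\Gamma'))\cong(\operatorname{Aut}(\Gamma),\operatorname{Aut}_I(\Gamma))$, i.e. there is a group isomorphism $\varphi\colon\operatorname{Aut}(\Gamma')\to\operatorname{Aut}(\Gamma)$ with $\varphi(\operatorname{Aut}_I(\Gamma'))=\operatorname{Aut}_I(\Gamma)$.
   Context: An incidence system is a tuple $\Gamma=(X,\ast,t,I)$ where $X$ is a non-empty set (of elements), $I$ is a finite set (of types), $t\colon X\to I$ is a surjective map (the type function), and $\ast$ is a symmetric binary relation on $X$ (the incidence relation) such that for all $x,y\in X$, if $x\neq y$ and $x\ast y$, then $t(x)\neq t(y)$. By convention, an element is not incident to itself. $\Gamma$ is finite if $X$ is finite. The degree of $x\in X$ is $|\{y\in X\mid y\ast x\}|$. A flag of $\Gamma$ is a subset $F\subset X$ such that $x\ast y$ for all $x,y\in F$ with $x\neq y$; its rank is $|F|$. A chamber is a flag of rank $|I|$. An incidence geometry is an incidence system in which every flag is contained in a chamber. A correlation of $\Gamma$ is a permutation $f$ of $X$ such that for all $x,y\in X$: $x\ast y\Leftrightarrow f(x)\ast f(y)$, and $t(x)=t(y)\Leftrightarrow t(f(x))=t(f(y))$. An automorphism of $\Gamma$ is a correlation $f$ with $t(f(x))=t(x)$ for all $x\in X$. $\operatorname{Aut}(\Gamma)$ denotes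 the group of all correlations of $\Gamma$ under composition, and $\operatorname{Aut}_I(\Gamma)$ denotes its normal subgroup consisting of the automorphisms of $\Gamma$ (the subscript $I$ is part of the notation for type-preserving automorphisms). *)

theory Defs
  imports "HOL-Algebra.Bij" "HOL-Algebra.Coset"
begin

record ('a, 'i) incidence_structure =
  elements :: "'a set"
  incidence :: "'a rel"
  type_of :: "'a \<Rightarrow> 'i"
  types :: "'i set"

locale incidence_system =
  fixes G :: "('a, 'i) incidence_structure"
  assumes elements_nonempty: "elements G \<noteq> {}"
    and finite_types: "finite (types G)"
    and type_surj: "type_of G ` elements G = types G"
    and incidence_subset: "incidence G \<subseteq> elements G \<times> elements G"
    and incidence_sym: "sym (incidence G)"
    and incidence_irrefl: "irrefl (incidence G)"
    and incident_types: "\<And>x y. (x, y) \<in> incidence G \<Longrightarrow> x \<noteq> y \<Longrightarrow> type_of G x \<noteq> type_of G y"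

text \<open>
  In an infinite structure \<^const>\<open>card\<close> would give an element of infinite degree the value 0;
  \<open>degree\<close> is meaningful for finite structures.
  In an incidence system every flag is finite, since its elements have pairwise distinct types.
\<close>

definition degree :: "('a, 'i) incidence_structure \<Rightarrow> 'a \<Rightarrow> nat" where
  "degree G x = card {y \<in> elements G. (y, x) \<in> incidence G}"

definition flag :: "('a, 'i) incidence_structure \<Rightarrow> 'a set \<Rightarrow> bool" where
  "flag G F \<longleftrightarrow> F \<subseteq> elements G \<and> (\<forall>x\<in>F. \<forall>y\<in>F. x \<noteq> y \<longrightarrow> (x, y) \<in> incidence G)"

definition rank :: "'a set \<Rightarrow> nat" where
  "rank F = card F"

definition chamber :: "('a, 'i) incidence_structure \<Rightarrow> 'a set \<Rightarrow> bool" where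
  "chamber G C \<longleftrightarrow> flag G C \<and> rank C = card (types G)"

locale incidence_geometry = incidence_system G
  for G :: "('a, 'i) incidence_structure" +
  assumes flag_in_chamber: "\<And>F. flag G F \<Longrightarrow> \<exists>C. chamber G C \<and> F \<subseteq> C"

text \<open>
  Permutations of the element set are taken from \<^const>\<open>Bij\<close>, i.e. they are extensional
  functions, so that each permutation is represented by exactly one HOL function.
\<close>

definition correlations :: "('a, 'i) incidence_structure \<Rightarrow> ('a \<Rightarrow> 'a) set" where
  "correlations G = {f \<in> Bij (elements G).
     \<forall>x\<in>elements G. \<forall>y\<in>elements G.
       ((x, y) \<in> incidence G \<longleftrightarrow> (f x, f y) \<in> incidence G) \<and>
       (type_of G x = type_of G y \<longleftrightarrow> type_of G (f x) = type_of G (f y))}"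

definition Aut :: "('a, 'i) incidence_structure \<Rightarrow> ('a \<Rightarrow> 'a) monoid" where
  "Aut G = BijGroup (elements G) \<lparr>carrier := correlations G\<rparr>"

definition Aut_I :: "('a, 'i) incidence_structure \<Rightarrow> ('a \<Rightarrow> 'a) set" where
  "Aut_I G = {f \<in> correlations G. \<forall>x\<in>elements G. type_of G (f x) = type_of G x}"

lemma correlations_subgroup: "subgroup (correlations G) (BijGroup (elements G))"
proof (rule subgroup.intro)
  show "correlations G \<subseteq> carrier (BijGroup (elements G))"
    by (auto simp: correlations_def BijGroup_def)
  show "\<one>\<^bsub>BijGroup (elements G)\<^esub> \<in> correlations G"
    by (auto simp: correlations_def BijGroup_def id_Bij)
next
  fix f g assume f: "f \<in> correlations G" and g: "g \<in> correlations G"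
  have "g x \<in> elements G" if "x \<in> elements G" for x
    using g that by (auto simp: correlations_def dest: Bij_imp_funcset)
  then show "f \<otimes>\<^bsub>BijGroup (elements G)\<^esub> g \<in> correlations G"
    using f g by (simp add: correlations_def BijGroup_def compose_Bij compose_eq)
next
  fix f assume f: "f \<in> correlations G"
  let ?h = "inv_into (elements G) f"
  have B: "f \<in> Bij (elements G)" using f by (simp add: correlations_def)
  have "f (?h x) = x" "?h x \<in> elements G" if "x \<in> elements G" for x
    using B that by (auto simp: Bij_def bij_betw_def f_inv_into_f inv_into_into)
  then show "inv\<^bsub>BijGroup (elements G)\<^esub> f \<in> correlations G"
    using f by (simp add: inv_BijGroup[OF B] correlations_def restrict_inv_into_Bij)
qed

lemma group_Aut: "group (Aut G)"
  by (simp add: Aut_def correlations_subgroup group_BijGroup subgroup.subgroup_is_group)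

lemma Aut_I_normal: "Aut_I G \<lhd> Aut G"
proof -
  interpret A: group "Aut G" by (rule group_Aut)
  let ?S = "elements G"
  have mult: "(f \<otimes>\<^bsub>Aut G\<^esub> g) x = f (g x)"
    if "f \<in> carrier (Aut G)" "g \<in> carrier (Aut G)" "x \<in> ?S" for f g x
    using that by (simp add: Aut_def BijGroup_def correlations_def compose_eq)
  have one: "\<one>\<^bsub>Aut G\<^esub> x = x" if "x \<in> ?S" for x
    using that by (simp add: Aut_def BijGroup_def)
  have mem: "f x \<in> ?S" if "f \<in> carrier (Aut G)" "x \<in> ?S" for f x
    using that by (auto simp: Aut_def correlations_def dest: Bij_imp_funcset)
  have inv1: "f ((inv\<^bsub>Aut G\<^esub> f) x) = x" if "f \<in> carrier (Aut G)" "x \<in> ?S" for f x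
    using mult[of f "inv\<^bsub>Aut G\<^esub> f" x] one that by simp
  have iff: "f \<in> Aut_I G \<longleftrightarrow>
      f \<in> carrier (Aut G) \<and> (\<forall>x\<in>?S. type_of G (f x) = type_of G x)" for f
    by (simp add: Aut_I_def Aut_def)
  have cong: "type_of G (f x) = type_of G (f y)"
    if "f \<in> carrier (Aut G)" "x \<in> ?S" "y \<in> ?S" "type_of G x = type_of G y" for f x y
    using that by (auto simp: Aut_def correlations_def)
  have "subgroup (Aut_I G) (Aut G)"
  proof (rule A.subgroupI)
    show "Aut_I G \<subseteq> carrier (Aut G)" by (auto simp: iff)
    have "\<one>\<^bsub>Aut G\<^esub> \<in> Aut_I G" by (simp add: iff one)
    then show "Aut_I G \<noteq> {}" by blast
    show "inv\<^bsub>Aut G\<^esub> f \<in> Aut_I G" if "f \<in> Aut_I G" for f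
      using that by (metis A.inv_closed iff inv1 mem)
    show "f \<otimes>\<^bsub>Aut G\<^esub> g \<in> Aut_I G" if "f \<in> Aut_I G" "g \<in> Aut_I G" for f g
      using that by (simp add: iff mult mem)
  qed
  moreover have "f \<otimes>\<^bsub>Aut G\<^esub> h \<otimes>\<^bsub>Aut G\<^esub> inv\<^bsub>Aut G\<^esub> f \<in> Aut_I G"
    if f: "f \<in> carrier (Aut G)" and h: "h \<in> Aut_I G" for f h
  proof -
    have hc: "h \<in> carrier (Aut G)" using h by (simp add: iff)
    have "type_of G (f (h ((inv\<^bsub>Aut G\<^esub> f) x))) = type_of G x" if x: "x \<in> ?S" for x
    proof -
      let ?y = "(inv\<^bsub>Aut G\<^esub> f) x"
      have y: "?y \<in> ?S" using mem[of "inv\<^bsub>Aut G\<^esub> f" x] f x by simp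
      then have "type_of G (h ?y) = type_of G ?y" using h by (simp add: iff)
      then have "type_of G (f (h ?y)) = type_of G (f ?y)"
        using cong f mem[OF hc y] y by blast
      then show ?thesis using inv1[OF f x] by simp
    qed
    then show ?thesis using f hc by (simp add: iff mult mem)
  qed
  ultimately show ?thesis by (simp add: A.normal_inv_iff)
qed

end

theory Submission
  imports Defs
begin

text \<open>
  Every edge \<open>e = {x, y}\<close> of \<open>\<Gamma>\<close> is completed to a chamber by new elements \<open>(e, k)\<close>, one for each
  type \<open>k\<close> other than those of \<open>x\<close> and \<open>y\<close>; two distinct elements are incident if they lie in a common
  completed edge. Since \<open>\<Gamma>\<close> has no triangles, every flag lies in a completed edge. The new elements
  are recognized by the fact that any two of their neighbours are incident: an old element has two
  old neighbours, which are not incident, again because there are no triangles. So every correlation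
  preserves the old elements. It is determined there, because \<open>(e, k)\<close> is determined by \<open>e\<close> and its
  type, and every correlation of \<open>\<Gamma>\<close> extends.
\<close>

section \<open>Correlations\<close>

text \<open>The conclusion about the two groups, as a relation between structures whose element
  types may differ. Completing the edges and renaming the elements can then be handled separately
  and chained by \<open>pair_iso_trans\<close>.\<close>

definition pair_iso :: "('b, 'i) incidence_structure \<Rightarrow> ('a, 'i) incidence_structure \<Rightarrow> bool" where
  "pair_iso H G \<longleftrightarrow> (\<exists>\<phi> \<in> iso (Aut H) (Aut G). \<phi> ` Aut_I H = Aut_I G)"

lemma pair_iso_trans:
  assumes "pair_iso K H" "pair_iso H G"
  shows "pair_iso K G"
proof -
  obtain \<phi> \<psi> where "\<phi> \<in> iso (Aut K) (Aut H)" "\<phi> ` Aut_I K = Aut_I H"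
    and "\<psi> \<in> iso (Aut H) (Aut G)" "\<psi> ` Aut_I H = Aut_I G"
    using assms by (auto simp: pair_iso_def)
  then show ?thesis
    unfolding pair_iso_def
    by (intro bexI[of _ "\<psi> \<circ> \<phi>"] iso_set_trans[of \<phi> _ "Aut H"]) (simp_all flip: image_image)
qed

lemma carrier_Aut [simp]: "carrier (Aut G) = correlations G"
  by (simp add: Aut_def)

lemma mult_Aut:
  "f \<in> correlations G \<Longrightarrow> g \<in> correlations G \<Longrightarrow> f \<otimes>\<^bsub>Aut G\<^esub> g = compose (elements G) f g"
  by (simp add: Aut_def BijGroup_def correlations_def)

lemma correlation_closed: "f \<in> correlations G \<Longrightarrow> x \<in> elements G \<Longrightarrow> f x \<in> elements G"
  by (auto simp: correlations_def dest: Bij_imp_funcset)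

lemma correlation_inj: "f \<in> correlations G \<Longrightarrow> inj_on f (elements G)"
  by (auto simp: correlations_def Bij_def bij_betw_def)

lemma correlation_image: "f \<in> correlations G \<Longrightarrow> f ` elements G = elements G"
  by (auto simp: correlations_def Bij_def bij_betw_def)

lemma correlation_incidence:
  "f \<in> correlations G \<Longrightarrow> x \<in> elements G \<Longrightarrow> y \<in> elements G \<Longrightarrow>
    (f x, f y) \<in> incidence G \<longleftrightarrow> (x, y) \<in> incidence G"
  by (auto simp: correlations_def)

lemma correlation_type:
  "f \<in> correlations G \<Longrightarrow> x \<in> elements G \<Longrightarrow> y \<in> elements G \<Longrightarrow>
    type_of G (f x) = type_of G (f y) \<longleftrightarrow> type_of G x = type_of G y"
  by (auto simp: correlations_def)

lemma correlation_extensional: "f \<in> correlations G \<Longrightarrow> f \<in> extensional (elements G)"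
  by (auto simp: correlations_def Bij_def)

text \<open>Acting on both coordinates, \<open>f\<close> maps the finite set \<open>R\<close>
  injectively into itself, hence onto itself. So \<open>(f x, f y)\<close> comes from a pair in
  \<open>R\<close>, which injectivity of \<open>f\<close> identifies with
  \<open>(x, y)\<close>.\<close>

lemma finite_inj_preserves_iff:
  assumes "finite R" "R \<subseteq> X \<times> X" "inj_on f X"
    and step: "\<And>x y. (x, y) \<in> R \<Longrightarrow> (f x, f y) \<in> R"
    and "x \<in> X" "y \<in> X" "(f x, f y) \<in> R"
  shows "(x, y) \<in> R"
proof -
  have "inj_on (map_prod f f) R"
    using assms(2,3) by (intro inj_on_subset[OF map_prod_inj_on]) auto
  moreover have "map_prod f f ` R \<subseteq> R"
    using step by auto
  ultimately have "map_prod f f ` R = R"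
    using \<open>finite R\<close> by (simp add: endo_inj_surj)
  with assms(7) have "(f x, f y) \<in> map_prod f f ` R"
    by simp
  then obtain a b where ab: "(a, b) \<in> R" "f x = f a" "f y = f b"
    by auto
  then have "x = a" "y = b"
    using assms(2,3,5,6) by (auto dest: inj_onD)
  then show ?thesis
    using ab by simp
qed

text \<open>Finiteness supplies surjectivity and the reverse implication for incidence, so a
  candidate correlation only has to be injective, to preserve incidence in one direction and to
  respect equality of types. \<open>restrict\<close> gives the extensional representative that
  \<open>Bij\<close> demands.\<close>

lemma correlation_of_finite:
  assumes fin: "finite (elements G)" and sub: "incidence G \<subseteq> elements G \<times> elements G"
    and closed: "f ` elements G \<subseteq> elements G" and inj: "inj_on f (elements G)"
    and inc: "\<And>x y. (x, y) \<in> incidence G \<Longrightarrow> (f x, f y) \<in> incidence G"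
    and ty: "\<And>x y. x \<in> elements G \<Longrightarrow> y \<in> elements G \<Longrightarrow>
      type_of G (f x) = type_of G (f y) \<longleftrightarrow> type_of G x = type_of G y"
  shows "restrict f (elements G) \<in> correlations G"
proof -
  have "f ` elements G = elements G"
    using endo_inj_surj[OF fin closed inj] .
  then have "restrict f (elements G) \<in> Bij (elements G)"
    using inj by (auto simp: Bij_def bij_betw_def)
  moreover have "finite (incidence G)"
    using finite_subset[OF sub] fin by simp
  then have "(f x, f y) \<in> incidence G \<longleftrightarrow> (x, y) \<in> incidence G"
    if "x \<in> elements G" "y \<in> elements G" for x y
    using finite_inj_preserves_iff[OF _ sub inj inc that] inc by blast
  ultimately show ?thesis
    using ty by (auto simp: correlations_def)
qed

text \<open>Restriction to an embedded copy of \<open>G\<close> inside \<open>H\<close>.\<close>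

lemma pair_iso_of_embedding:
  fixes G :: "('a, 'i) incidence_structure" and H :: "('b, 'i) incidence_structure"
  assumes inj: "inj_on \<iota> (elements G)" and sub: "\<iota> ` elements G \<subseteq> elements H"
    and inc: "\<And>x y. x \<in> elements G \<Longrightarrow> y \<in> elements G \<Longrightarrow>
      (\<iota> x, \<iota> y) \<in> incidence H \<longleftrightarrow> (x, y) \<in> incidence G"
    and ty: "\<And>x. x \<in> elements G \<Longrightarrow> type_of H (\<iota> x) = type_of G x"
    and types: "type_of H ` elements H \<subseteq> type_of G ` elements G"
    and stable: "\<And>f. f \<in> correlations H \<Longrightarrow> f ` \<iota> ` elements G = \<iota> ` elements G"
    and determined: "\<And>f g. f \<in> correlations H \<Longrightarrow> g \<in> correlations H \<Longrightarrow>
      (\<And>x. x \<in> elements G \<Longrightarrow> f (\<iota> x) = g (\<iota> x)) \<Longrightarrow> f = g"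
    and extends: "\<And>f. f \<in> correlations G \<Longrightarrow>
      \<exists>g \<in> correlations H. \<forall>x \<in> elements G. g (\<iota> x) = \<iota> (f x)"
  shows "pair_iso H G"
proof -
  \<comment> \<open>By \<open>stable\<close>, \<open>f (\<iota> x)\<close> stays in the embedded
    copy for \<open>x\<close> in \<open>G\<close>, so \<open>inv_into\<close> yields a true
    preimage. The bounded abstraction makes \<open>\<phi> f\<close> extensional.\<close>
  define \<phi> where "\<phi> f = (\<lambda>x \<in> elements G. inv_into (elements G) \<iota> (f (\<iota> x)))" for f
  have iota: "\<iota> x \<in> elements H" if "x \<in> elements G" for x
    using sub that by blast
  have closed: "\<phi> f x \<in> elements G" and key: "\<iota> (\<phi> f x) = f (\<iota> x)"
    if "f \<in> correlations H" "x \<in> elements G" for f x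
  proof -
    have "f (\<iota> x) \<in> \<iota> ` elements G"
      using stable[OF that(1)] that(2) by blast
    then show "\<phi> f x \<in> elements G" "\<iota> (\<phi> f x) = f (\<iota> x)"
      using that(2) by (auto simp: \<phi>_def inj inv_into_into f_inv_into_f)
  qed
  have corr: "\<phi> f \<in> correlations G" if f: "f \<in> correlations H" for f
  proof -
    have "inj_on (\<phi> f) (elements G)"
    proof (rule inj_onI)
      fix x y assume xy: "x \<in> elements G" "y \<in> elements G" "\<phi> f x = \<phi> f y"
      then have "f (\<iota> x) = f (\<iota> y)"
        using key[OF f] by metis
      then have "\<iota> x = \<iota> y"
        using correlation_inj[OF f] xy iota by (auto dest: inj_onD)
      then show "x = y"
        using inj xy by (auto dest: inj_onD)
    qed
    moreover have "\<phi> f ` elements G = elements G"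
    proof
      show "\<phi> f ` elements G \<subseteq> elements G"
        using closed[OF f] by blast
      show "elements G \<subseteq> \<phi> f ` elements G"
      proof
        fix y assume y: "y \<in> elements G"
        then have "\<iota> y \<in> f ` \<iota> ` elements G"
          using stable[OF f] by simp
        then obtain x where x: "x \<in> elements G" "\<iota> y = \<iota> (\<phi> f x)"
          using key[OF f] by auto
        then have "y = \<phi> f x"
          using inj y closed[OF f x(1)] by (auto dest: inj_onD)
        then show "y \<in> \<phi> f ` elements G"
          using x by blast
      qed
    qed
    ultimately have "\<phi> f \<in> Bij (elements G)"
      by (simp add: Bij_def bij_betw_def \<phi>_def)
    moreover have "(\<phi> f x, \<phi> f y) \<in> incidence G \<longleftrightarrow> (x, y) \<in> incidence G"
      and "type_of G (\<phi> f x) = type_of G (\<phi> f y) \<longleftrightarrow> type_of G x = type_of G y"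
      if "x \<in> elements G" "y \<in> elements G" for x y
      using that inc ty closed[OF f] key[OF f] iota
        correlation_incidence[OF f, of "\<iota> x" "\<iota> y"] correlation_type[OF f, of "\<iota> x" "\<iota> y"]
      by metis+
    ultimately show ?thesis
      by (auto simp: correlations_def)
  qed
  have "\<phi> \<in> hom (Aut H) (Aut G)"
  proof (rule homI)
    fix f g assume "f \<in> carrier (Aut H)" "g \<in> carrier (Aut H)"
    then have fg: "f \<in> correlations H" "g \<in> correlations H"
      by simp_all
    have "\<phi> (compose (elements H) f g) = compose (elements G) (\<phi> f) (\<phi> g)"
    proof (rule extensionalityI[of _ "elements G"])
      fix x assume x: "x \<in> elements G"
      then show "\<phi> (compose (elements H) f g) x = compose (elements G) (\<phi> f) (\<phi> g) x"
        using key[OF fg(2) x] closed[OF fg(2) x] iota[OF x] by (simp add: \<phi>_def compose_eq)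
    qed (auto simp: \<phi>_def compose_def)
    then show "\<phi> (f \<otimes>\<^bsub>Aut H\<^esub> g) = \<phi> f \<otimes>\<^bsub>Aut G\<^esub> \<phi> g"
      using fg corr by (simp add: mult_Aut)
  qed (use corr in auto)
  moreover have "inj_on \<phi> (correlations H)"
  proof (rule inj_onI)
    fix f g assume "f \<in> correlations H" "g \<in> correlations H" "\<phi> f = \<phi> g"
    then show "f = g"
      using determined key by metis
  qed
  moreover have surj: "\<exists>f \<in> correlations H. \<phi> f = g" if g: "g \<in> correlations G" for g
  proof -
    obtain f where f: "f \<in> correlations H" "\<forall>x \<in> elements G. f (\<iota> x) = \<iota> (g x)"
      using extends[OF g] by blast
    have "\<phi> f = g"
      using f g correlation_closed[OF g] inj
      by (intro extensionalityI[of _ "elements G"]) (auto simp: \<phi>_def correlation_extensional)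
    then show ?thesis
      using f by blast
  qed
  ultimately have "\<phi> \<in> iso (Aut H) (Aut G)"
    using corr by (auto simp: iso_def bij_betw_def)
  moreover have AutI: "f \<in> Aut_I H \<longleftrightarrow> \<phi> f \<in> Aut_I G" if f: "f \<in> correlations H" for f
  proof
    assume "f \<in> Aut_I H"
    then show "\<phi> f \<in> Aut_I G"
      using corr[OF f] closed[OF f] key[OF f] iota ty unfolding Aut_I_def
      by (smt (verit, best) mem_Collect_eq)
  next
    assume *: "\<phi> f \<in> Aut_I G"
    \<comment> \<open>By \<open>types\<close>, \<open>u\<close> has the same type as some
      \<open>\<iota> x\<close>. Since \<open>f\<close> respects equality of types, type preservation
      on the copy carries over to \<open>u\<close>.\<close>
    have "type_of H (f u) = type_of H u" if u: "u \<in> elements H" for u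
    proof -
      obtain x where x: "x \<in> elements G" "type_of H u = type_of G x"
        using types u by blast
      then have "type_of H (f u) = type_of H (f (\<iota> x))"
        using correlation_type[OF f u iota] ty by simp
      also have "\<dots> = type_of G x"
        using * x ty closed[OF f] key[OF f] unfolding Aut_I_def
        by (metis (mono_tags, lifting) mem_Collect_eq)
      finally show ?thesis
        using x by simp
    qed
    then show "f \<in> Aut_I H"
      using f by (simp add: Aut_I_def)
  qed
  then have "\<phi> ` Aut_I H = Aut_I G"
  proof -
    have "Aut_I H \<subseteq> correlations H" "Aut_I G \<subseteq> correlations G"
      by (auto simp: Aut_I_def)
    then show ?thesis
      using AutI surj by blast
  qed
  ultimately show ?thesis
    unfolding pair_iso_def by blast
qed

section \<open>Relabelling the elements\<close>

text \<open>Transport of structure along \<open>h\<close>, meant for \<open>h\<close> injective on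
  the elements. It moves the completion, whose element type is built from \<open>'a\<close> and
  \<open>'i\<close>, to the natural numbers.\<close>

definition relabel :: "('b \<Rightarrow> 'c) \<Rightarrow> ('b, 'i) incidence_structure \<Rightarrow> ('c, 'i) incidence_structure" where
  "relabel h G = \<lparr>elements = h ` elements G, incidence = map_prod h h ` incidence G,
     type_of = type_of G \<circ> inv_into (elements G) h, types = types G\<rparr>"

lemma relabel_incidence:
  assumes "incidence G \<subseteq> elements G \<times> elements G" "inj_on h (elements G)"
    and "x \<in> elements G" "y \<in> elements G"
  shows "(h x, h y) \<in> incidence (relabel h G) \<longleftrightarrow> (x, y) \<in> incidence G"
proof
  assume "(h x, h y) \<in> incidence (relabel h G)"
  then obtain a b where ab: "(a, b) \<in> incidence G" "h x = h a" "h y = h b"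
    by (auto simp: relabel_def)
  then have "x = a" "y = b"
    using assms by (auto dest: inj_onD)
  then show "(x, y) \<in> incidence G"
    using ab by simp
qed (auto simp: relabel_def)

text \<open>Here the embedded copy is the whole of \<open>relabel h G\<close>: stability is
  surjectivity of correlations, determination is extensionality, and a correlation of
  \<open>G\<close> extends by conjugation with \<open>h\<close>.\<close>

lemma pair_iso_relabel:
  assumes "finite (elements G)" and sub: "incidence G \<subseteq> elements G \<times> elements G"
    and inj: "inj_on h (elements G)"
  shows "pair_iso (relabel h G) G"
proof (rule pair_iso_of_embedding[where \<iota> = h])
  let ?H = "relabel h G" and ?inv = "inv_into (elements G) h"
  have els: "elements ?H = h ` elements G"
    by (simp add: relabel_def)
  show "f ` h ` elements G = h ` elements G" if "f \<in> correlations ?H" for f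
    using correlation_image[OF that] els by simp
  show "f = g" if "f \<in> correlations ?H" "g \<in> correlations ?H"
    "\<And>x. x \<in> elements G \<Longrightarrow> f (h x) = g (h x)" for f g
    using that els correlation_extensional[of f ?H] correlation_extensional[of g ?H]
    by (intro extensionalityI[of _ "elements ?H"]) auto
  show "\<exists>g \<in> correlations ?H. \<forall>x \<in> elements G. g (h x) = h (f x)"
    if f: "f \<in> correlations G" for f
  proof
    show "restrict (h \<circ> f \<circ> ?inv) (elements ?H) \<in> correlations ?H"
    proof (rule correlation_of_finite)
      show "inj_on (h \<circ> f \<circ> ?inv) (elements ?H)"
        using inj els correlation_closed[OF f] inj_on_eq_iff[OF inj]
          inj_on_eq_iff[OF correlation_inj[OF f]]
        by (auto intro!: inj_onI)
      show "((h \<circ> f \<circ> ?inv) u, (h \<circ> f \<circ> ?inv) v) \<in> incidence ?H"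
        if uv: "(u, v) \<in> incidence ?H" for u v
      proof -
        obtain x y where xy: "u = h x" "v = h y" "(x, y) \<in> incidence G"
          using uv by (auto simp: relabel_def)
        then have "x \<in> elements G" "y \<in> elements G"
          using sub by auto
        then show ?thesis
          using xy inj sub f
          by (simp add: relabel_incidence correlation_closed correlation_incidence)
      qed
      show "type_of ?H ((h \<circ> f \<circ> ?inv) u) = type_of ?H ((h \<circ> f \<circ> ?inv) v) \<longleftrightarrow>
          type_of ?H u = type_of ?H v"
        if uv: "u \<in> elements ?H" "v \<in> elements ?H" for u v
        using uv inj f
        by (auto simp: relabel_def correlation_closed correlation_type)
    qed (use assms f in \<open>auto simp: relabel_def correlation_closed\<close>)
    show "\<forall>x \<in> elements G. restrict (h \<circ> f \<circ> ?inv) (elements ?H) (h x) = h (f x)"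
      using inj els by simp
  qed
qed (use assms in \<open>auto simp: relabel_def relabel_incidence[unfolded relabel_def, simplified]\<close>)

text \<open>Flags correspond under \<open>h\<close> and keep their cardinality. A flag is pulled
  back to \<open>G\<close>, enlarged to a chamber there, and the chamber is mapped forward
  again.\<close>

lemma incidence_geometry_relabel:
  assumes "incidence_geometry G" and inj: "inj_on h (elements G)"
  shows "incidence_geometry (relabel h G)"
proof -
  interpret incidence_geometry G by fact
  let ?H = "relabel h G"
  note sub = incidence_subset
  have els: "elements ?H = h ` elements G"
    by (simp add: relabel_def)
  have ty: "type_of ?H (h x) = type_of G x" if "x \<in> elements G" for x
    using that inj by (simp add: relabel_def)
  have flag: "flag ?H (h ` F) \<longleftrightarrow> flag G F" if "F \<subseteq> elements G" for F
  proof -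
    have "(h x, h y) \<in> incidence ?H \<longleftrightarrow> (x, y) \<in> incidence G" "h x = h y \<longleftrightarrow> x = y"
      if "x \<in> F" "y \<in> F" for x y
      using that \<open>F \<subseteq> elements G\<close> relabel_incidence[OF sub inj, of x y] inj
      by (blast dest: inj_onD)+
    then show ?thesis
      using that unfolding flag_def els by blast
  qed
  show ?thesis
  proof
    show "incidence ?H \<subseteq> elements ?H \<times> elements ?H"
      using sub by (auto simp: relabel_def)
    show "sym (incidence ?H)"
      using incidence_sym by (force simp: relabel_def sym_def)
    show "irrefl (incidence ?H)"
    proof (rule irreflI, rule notI)
      fix u assume "(u, u) \<in> incidence ?H"
      then obtain x y where "(x, y) \<in> incidence G" "h x = h y"
        by (auto simp: relabel_def)
      then show False
        using sub inj incidence_irrefl by (auto dest!: inj_onD simp: irrefl_def)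
    qed
    show "type_of ?H u \<noteq> type_of ?H v" if uv: "(u, v) \<in> incidence ?H" "u \<noteq> v" for u v
    proof -
      obtain x y where xy: "u = h x" "v = h y" "(x, y) \<in> incidence G"
        using uv by (auto simp: relabel_def)
      then have "x \<in> elements G" "y \<in> elements G"
        using sub by auto
      then show ?thesis
        using xy uv incident_types[of x y] by (auto simp: ty)
    qed
    show "\<exists>C. chamber ?H C \<and> F \<subseteq> C" if F: "flag ?H F" for F
    proof -
      obtain F' where F': "F' \<subseteq> elements G" "F = h ` F'"
        using F els by (metis flag_def subset_imageE)
      then obtain C where C: "chamber G C" "F' \<subseteq> C"
        using flag_in_chamber flag F by blast
      then have CX: "C \<subseteq> elements G"
        by (simp add: chamber_def flag_def)
      have "chamber ?H (h ` C)"
        using C flag[OF CX] card_image[OF inj_on_subset[OF inj CX]]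
        by (simp add: chamber_def rank_def relabel_def)
      then show ?thesis
        using C F' by blast
    qed
    show "type_of ?H ` elements ?H = types ?H"
      using type_surj ty by (simp add: els image_image) (simp add: relabel_def)
  qed (use elements_nonempty finite_types in \<open>auto simp: relabel_def\<close>)
qed

section \<open>Completing the edges to chambers\<close>

definition edges :: "('a, 'i) incidence_structure \<Rightarrow> 'a set set" where
  "edges G = {{x, y} | x y. (x, y) \<in> incidence G}"

text \<open>New elements carry the edge itself as a tag, so blocks of different edges share old
  elements only. As edges are unordered sets, a correlation of \<open>G\<close> acts on the tags by
  taking images.\<close>

definition block :: "('a, 'i) incidence_structure \<Rightarrow> 'a set \<Rightarrow> ('a + 'a set \<times> 'i) set" where
  "block G e = Inl ` e \<union> Inr ` ({e} \<times> (types G - type_of G ` e))"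

text \<open>Taking the union of the blocks loses no old element once all degrees are positive, since
  each then lies on an edge (\<open>Inl_elements\<close>).\<close>

definition completion ::
    "('a, 'i) incidence_structure \<Rightarrow> ('a + 'a set \<times> 'i, 'i) incidence_structure" where
  "completion G = \<lparr>elements = \<Union>(block G ` edges G),
     incidence = {(u, v). u \<noteq> v \<and> (\<exists>e \<in> edges G. u \<in> block G e \<and> v \<in> block G e)},
     type_of = case_sum (type_of G) snd, types = types G\<rparr>"

lemma Inl_block [simp]: "Inl x \<in> block G e \<longleftrightarrow> x \<in> e"
  by (auto simp: block_def)

lemma Inr_block [simp]: "Inr (d, k) \<in> block G e \<longleftrightarrow> d = e \<and> k \<in> types G - type_of G ` e"
  by (auto simp: block_def)

lemma completion_sel:
  "u \<in> elements (completion G) \<longleftrightarrow> (\<exists>e \<in> edges G. u \<in> block G e)"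
  "(u, v) \<in> incidence (completion G) \<longleftrightarrow>
    u \<noteq> v \<and> (\<exists>e \<in> edges G. u \<in> block G e \<and> v \<in> block G e)"
  "type_of (completion G) (Inl x) = type_of G x"
  "type_of (completion G) (Inr p) = snd p"
  "types (completion G) = types G"
  by (auto simp: completion_def)

section \<open>Triangle-free systems in which every element has two neighbours\<close>

locale thick_triangle_free = incidence_system G
  for G :: "('a, 'i) incidence_structure" +
  assumes finite_elements: "finite (elements G)"
    and degree_ge_2: "x \<in> elements G \<Longrightarrow> 2 \<le> degree G x"
    and flag_rank_le_2: "flag G F \<Longrightarrow> rank F \<le> 2"
begin

abbreviation "H \<equiv> completion G"

lemma incidence_commute: "(x, y) \<in> incidence G \<longleftrightarrow> (y, x) \<in> incidence G"
  using incidence_sym by (auto dest: symD)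

lemma incidence_neq: "(x, y) \<in> incidence G \<Longrightarrow> x \<noteq> y"
  using incidence_irrefl by (auto simp: irrefl_def)

lemma incidence_elements: "(x, y) \<in> incidence G \<Longrightarrow> x \<in> elements G \<and> y \<in> elements G"
  using incidence_subset by auto

lemma edge_subset: "e \<in> edges G \<Longrightarrow> e \<subseteq> elements G"
  by (auto simp: edges_def dest: incidence_elements)

lemma edge_incidence: "e \<in> edges G \<Longrightarrow> x \<in> e \<Longrightarrow> y \<in> e \<Longrightarrow> x \<noteq> y \<Longrightarrow> (x, y) \<in> incidence G"
  by (auto simp: edges_def incidence_commute)

lemma edge_eq: "e \<in> edges G \<Longrightarrow> x \<in> e \<Longrightarrow> y \<in> e \<Longrightarrow> x \<noteq> y \<Longrightarrow> e = {x, y}"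
  by (auto simp: edges_def)

lemma two_neighbours:
  assumes "x \<in> elements G"
  obtains y z where "(x, y) \<in> incidence G" "(x, z) \<in> incidence G" "y \<noteq> z"
proof -
  let ?N = "{y \<in> elements G. (y, x) \<in> incidence G}"
  have "\<not> card ?N \<le> Suc 0"
    using degree_ge_2[OF assms] by (simp add: degree_def)
  then obtain y z where "y \<in> ?N" "z \<in> ?N" "y \<noteq> z"
    using finite_elements by (auto simp: card_le_Suc0_iff_eq)
  then show ?thesis
    using that incidence_commute by blast
qed

text \<open>Irreflexivity makes three mutually incident elements distinct, so they would form a flag
  of rank three.\<close>

lemma no_triangle:
  assumes "(x, y) \<in> incidence G" "(x, z) \<in> incidence G" "(y, z) \<in> incidence G"
  shows False
proof -
  have "flag G {x, y, z}"
    using assms incidence_elements by (auto simp: flag_def incidence_commute)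
  moreover have "rank {x, y, z} = 3"
    using assms incidence_neq by (auto simp: rank_def card_insert_if)
  ultimately show False
    using flag_rank_le_2 by fastforce
qed

section \<open>The completion as a finite incidence geometry\<close>

lemma Inl_elements [simp]: "Inl x \<in> elements H \<longleftrightarrow> x \<in> elements G"
proof
  assume "x \<in> elements G"
  then obtain y where "(x, y) \<in> incidence G"
    using two_neighbours by blast
  then show "Inl x \<in> elements H"
    by (auto simp: completion_sel edges_def)
qed (auto simp: completion_sel dest: edge_subset)

lemma Inr_elements [simp]:
  "Inr (e, k) \<in> elements H \<longleftrightarrow> e \<in> edges G \<and> k \<in> types G - type_of G ` e"
  by (auto simp: completion_sel)

text \<open>Two distinct old elements of one block are the two ends of its edge, so they were
  already incident in \<open>G\<close>.\<close>

lemma Inl_incidence [simp]: "(Inl x, Inl y) \<in> incidence H \<longleftrightarrow> (x, y) \<in> incidence G"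
proof
  assume "(x, y) \<in> incidence G"
  then show "(Inl x, Inl y) \<in> incidence H"
    using incidence_neq by (auto simp: completion_sel edges_def)
qed (auto simp: completion_sel intro: edge_incidence)

lemma finite_completion: "finite (elements H)"
proof -
  have "elements H \<subseteq> Inl ` elements G \<union> Inr ` (Pow (elements G) \<times> types G)"
  proof
    fix u assume "u \<in> elements H"
    then show "u \<in> Inl ` elements G \<union> Inr ` (Pow (elements G) \<times> types G)"
      using edge_subset by (cases u) auto
  qed
  then show ?thesis
    using finite_elements finite_types finite_subset by blast
qed

lemma completion_incidence_subset: "incidence H \<subseteq> elements H \<times> elements H"
  by (auto simp: completion_sel)

text \<open>The ends of \<open>e\<close> have different types, and the new elements supply each
  remaining type once. This gives both the rank needed in \<open>block_chamber\<close> and the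
  distinctness of types of incident elements.\<close>

lemma bij_betw_type_block:
  assumes e: "e \<in> edges G"
  shows "bij_betw (type_of H) (block G e) (types G)"
proof -
  have "inj_on (type_of G) e"
    using incident_types edge_incidence[OF e] by (metis inj_onI)
  have "inj_on (type_of H) (block G e)"
  proof (rule inj_onI)
    fix u v assume "u \<in> block G e" "v \<in> block G e" "type_of H u = type_of H v"
    then show "u = v"
      using inj_onD[OF \<open>inj_on (type_of G) e\<close>]
      by (cases u; cases v) (auto simp: completion_sel(3,4))
  qed
  moreover have "type_of G ` e \<subseteq> types G"
    using edge_subset[OF e] type_surj by blast
  then have "type_of H ` block G e = types G"
    by (auto simp: block_def image_Un image_image completion_sel(3,4))
  ultimately show ?thesis
    by (simp add: bij_betw_def)
qed

lemma type_completion: "u \<in> elements H \<Longrightarrow> type_of H u \<in> types G"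
  using bij_betw_type_block by (fastforce simp: completion_sel bij_betw_def)

lemma block_chamber:
  assumes "e \<in> edges G"
  shows "chamber H (block G e)"
proof -
  have "rank (block G e) = card (types H)"
    using bij_betw_same_card[OF bij_betw_type_block[OF assms]]
    by (simp add: rank_def completion_sel)
  then show ?thesis
    using assms by (auto simp: chamber_def flag_def completion_sel)
qed

text \<open>A new element \<open>(e, k)\<close> lies in the block of \<open>e\<close> only, so a
  flag containing it is confined to that block. A flag of old elements has at most two members by
  \<open>no_triangle\<close>: two members form an edge, and a single one is extended by a
  neighbour.\<close>

lemma flag_in_block:
  assumes F: "flag H F"
  shows "\<exists>e \<in> edges G. F \<subseteq> block G e"
proof (cases "\<exists>e k. Inr (e, k) \<in> F")
  case True
  then obtain e k where ek: "Inr (e, k) \<in> F"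
    by blast
  then have e: "Inr (e, k) \<in> block G e" "e \<in> edges G"
    using F by (auto simp: flag_def dest!: subsetD)
  moreover have "u \<in> block G e" if u: "u \<in> F" for u
    using F ek u e by (cases "u = Inr (e, k)") (auto simp: flag_def completion_sel)
  ultimately show ?thesis
    by blast
next
  case False
  define F' where "F' = Inl -` F"
  have FF': "F = Inl ` F'"
  proof -
    have "u \<in> Inl ` F'" if "u \<in> F" for u
      using that False by (cases u) (auto simp: F'_def)
    then show ?thesis
      by (auto simp: F'_def)
  qed
  have F': "F' \<subseteq> elements G" "\<And>x y. x \<in> F' \<Longrightarrow> y \<in> F' \<Longrightarrow> x \<noteq> y \<Longrightarrow> (x, y) \<in> incidence G"
    using F by (auto simp: flag_def FF' dest: subsetD)
  show ?thesis
  proof (cases "\<exists>x \<in> F'. \<exists>y \<in> F'. x \<noteq> y")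
    case True
    then obtain x y where xy: "x \<in> F'" "y \<in> F'" "x \<noteq> y"
      by blast
    have "z = x \<or> z = y" if "z \<in> F'" for z
      using no_triangle[of x y z] F'(2) xy that by blast
    then have "F' = {x, y}"
      using xy by blast
    then show ?thesis
      using F'(2)[OF xy] by (auto simp: FF' edges_def)
  next
    case False
    \<comment> \<open>The fallback \<open>x0\<close> serves the empty flag, which must also be put
      into some block.\<close>
    obtain x0 where "x0 \<in> elements G"
      using elements_nonempty by blast
    then obtain x where x: "x \<in> elements G" "F' \<subseteq> {x}"
      using False F'(1) by (cases "F' = {}") blast+
    then obtain y where "(x, y) \<in> incidence G"
      using two_neighbours by blast
    then have "{x, y} \<in> edges G"
      by (auto simp: edges_def)
    then show ?thesis
      using x by (intro bexI[of _ "{x, y}"]) (auto simp: FF')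
  qed
qed

lemma incidence_geometry_completion: "incidence_geometry H"
proof
  show "elements H \<noteq> {}"
    using elements_nonempty Inl_elements by blast
  show "finite (types H)"
    by (simp add: completion_sel finite_types)
  show "type_of H ` elements H = types H"
  proof
    show "types H \<subseteq> type_of H ` elements H"
    proof
      fix k assume "k \<in> types H"
      then have "k \<in> type_of G ` elements G"
        by (simp add: type_surj completion_sel(5))
      then obtain x where "x \<in> elements G" "type_of G x = k"
        by blast
      then show "k \<in> type_of H ` elements H"
        by (intro image_eqI[of _ _ "Inl x"]) (simp_all add: completion_sel(3))
    qed
  qed (auto simp: completion_sel(5) type_completion)
  show "incidence H \<subseteq> elements H \<times> elements H"
    by (rule completion_incidence_subset)
  show "sym (incidence H)"
    by (auto simp: sym_def completion_sel)
  show "irrefl (incidence H)"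
    by (auto simp: irrefl_def completion_sel)
  show "type_of H u \<noteq> type_of H v" if "(u, v) \<in> incidence H" "u \<noteq> v" for u v
    using that bij_betw_type_block by (auto simp: completion_sel(2) bij_betw_def dest: inj_onD)
  show "\<exists>C. chamber H C \<and> F \<subseteq> C" if "flag H F" for F
    using flag_in_block[OF that] block_chamber by blast
qed

section \<open>How correlations of the completion act on old and new elements\<close>

lemma old_iff:
  assumes "u \<in> elements H"
  shows "u \<in> Inl ` elements G \<longleftrightarrow>
    (\<exists>v \<in> elements H. \<exists>w \<in> elements H. (u, v) \<in> incidence H \<and> (u, w) \<in> incidence H \<and>
      v \<noteq> w \<and> (v, w) \<notin> incidence H)"
    (is "_ \<longleftrightarrow> ?R")
proof
  assume "u \<in> Inl ` elements G"
  then obtain x where x: "u = Inl x" "x \<in> elements G"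
    by blast
  obtain y z where yz: "(x, y) \<in> incidence G" "(x, z) \<in> incidence G" "y \<noteq> z"
    using two_neighbours[OF x(2)] .
  then show ?R
    using no_triangle[OF yz(1,2)] x incidence_elements
    by (intro bexI[of _ "Inl y"] bexI[of _ "Inl z"]) auto
next
  assume ?R
  \<comment> \<open>All neighbours of a new element lie in its only block, so two distinct ones are
    incident, against the assumption.\<close>
  then show "u \<in> Inl ` elements G"
    using assms by (cases u) (auto simp: completion_sel(2))
qed

text \<open>The criterion in \<open>old_iff\<close> speaks of incidence and equality alone, both of
  which \<open>f\<close> preserves and reflects.\<close>

lemma correlation_old_iff:
  assumes f: "f \<in> correlations H" and u: "u \<in> elements H"
  shows "f u \<in> Inl ` elements G \<longleftrightarrow> u \<in> Inl ` elements G"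
proof -
  \<comment> \<open>Letting the witnesses range over the image of \<open>f\<close>, which is all of
    \<open>elements H\<close>, allows them to be pulled back along \<open>f\<close>.\<close>
  have "f u \<in> Inl ` elements G \<longleftrightarrow>
    (\<exists>v \<in> f ` elements H. \<exists>w \<in> f ` elements H. (f u, v) \<in> incidence H \<and> (f u, w) \<in> incidence H \<and>
      v \<noteq> w \<and> (v, w) \<notin> incidence H)"
    using old_iff[OF correlation_closed[OF f u]] by (simp add: correlation_image[OF f])
  also have "\<dots> \<longleftrightarrow> u \<in> Inl ` elements G"
    using old_iff[OF u] u correlation_incidence[OF f] inj_on_eq_iff[OF correlation_inj[OF f]]
    by simp
  finally show ?thesis .
qed

lemma correlation_old:
  assumes "f \<in> correlations H" "x \<in> elements G"
  obtains y where "y \<in> elements G" "f (Inl x) = Inl y"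
  using correlation_old_iff[OF assms(1), of "Inl x"] assms(2) by auto

text \<open>The preimage under \<open>Inl\<close> is the edge joining the images of the two ends of
  \<open>e\<close>. The new element \<open>f (Inr (e, k))\<close> is incident to both images, so
  both lie on its edge, and two distinct elements determine an edge. In this form the edge visibly
  depends only on the values of \<open>f\<close> at old elements.\<close>

lemma correlation_new:
  assumes f: "f \<in> correlations H" and new: "Inr (e, k) \<in> elements H" and "x \<in> e" "y \<in> e" "x \<noteq> y"
  shows "\<exists>l. f (Inr (e, k)) = Inr (Inl -` {f (Inl x), f (Inl y)}, l)"
proof -
  have e: "e \<in> edges G" and xy: "x \<in> elements G" "y \<in> elements G"
    using assms edge_subset by auto
  obtain a b where ab: "f (Inl x) = Inl a" "f (Inl y) = Inl b"
    using correlation_old[OF f] xy by metis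
  have "a \<noteq> b"
    using inj_on_eq_iff[OF correlation_inj[OF f], of "Inl x" "Inl y"] ab xy \<open>x \<noteq> y\<close> by auto
  have "f (Inr (e, k)) \<notin> Inl ` elements G"
    using correlation_old_iff[OF f new] by auto
  moreover have "f (Inr (e, k)) \<in> elements H"
    using correlation_closed[OF f new] .
  ultimately obtain d l where dl: "f (Inr (e, k)) = Inr (d, l)" "d \<in> edges G"
    by (cases "f (Inr (e, k))") auto
  have "(Inl z, Inr (e, k)) \<in> incidence H" if "z \<in> e" for z
    using that new e by (auto simp: completion_sel(2))
  then have "(Inl a, Inr (d, l)) \<in> incidence H" "(Inl b, Inr (d, l)) \<in> incidence H"
    using correlation_incidence[OF f] xy new assms(3,4) dl(1) ab Inl_elements by metis+
  then have "a \<in> d" "b \<in> d"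
    by (auto simp: completion_sel(2))
  then have "d = Inl -` {Inl a, Inl b}"
    using edge_eq[OF dl(2) _ _ \<open>a \<noteq> b\<close>] by auto
  then show ?thesis
    using dl ab by simp
qed

lemma correlation_determined:
  assumes f: "f \<in> correlations H" and g: "g \<in> correlations H"
    and eq: "\<And>x. x \<in> elements G \<Longrightarrow> f (Inl x) = g (Inl x)"
  shows "f = g"
proof (rule extensionalityI[of _ "elements H"])
  fix u assume u: "u \<in> elements H"
  show "f u = g u"
  proof (cases u)
    case (Inl x)
    then show ?thesis
      using u eq by simp
  next
    case (Inr p)
    then obtain e k where ek: "u = Inr (e, k)"
      by (cases p) auto
    then have e: "e \<in> edges G" and "k \<in> types G"
      using u by auto
    obtain x y where xy: "x \<in> e" "y \<in> e" "x \<noteq> y"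
      using e incidence_neq unfolding edges_def by blast
    \<comment> \<open>An old element of the same type as \<open>u\<close>: the type of
      \<open>f u\<close> equals that of \<open>f (Inl z)\<close>, and likewise for \<open>g\<close>,
      so agreement on old elements fixes the type of the image.\<close>
    obtain z where z: "z \<in> elements G" "type_of G z = k"
      using \<open>k \<in> types G\<close>[folded type_surj] by blast
    have "type_of H (f u) = type_of H (f (Inl z))" "type_of H (g u) = type_of H (g (Inl z))"
      using f g u z correlation_type[of _ H u "Inl z"] by (auto simp: ek completion_sel(3,4))
    then have "type_of H (f u) = type_of H (g u)"
      using eq z by simp
    moreover obtain l m where "f u = Inr (Inl -` {f (Inl x), f (Inl y)}, l)"
      "g u = Inr (Inl -` {f (Inl x), f (Inl y)}, m)"
      using correlation_new[OF f u[unfolded ek] xy] correlation_new[OF g u[unfolded ek] xy]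
        eq[of x] eq[of y] subsetD[OF edge_subset[OF e]] xy by (auto simp: ek)
    ultimately show ?thesis
      by (simp add: completion_sel)
  qed
qed (use f g in \<open>simp_all add: correlation_extensional\<close>)

lemma correlation_edge: "f \<in> correlations G \<Longrightarrow> e \<in> edges G \<Longrightarrow> f ` e \<in> edges G"
proof -
  assume f: "f \<in> correlations G" and "e \<in> edges G"
  then obtain x y where xy: "e = {x, y}" "(x, y) \<in> incidence G"
    by (auto simp: edges_def)
  then have "(f x, f y) \<in> incidence G"
    using f incidence_elements by (simp add: correlation_incidence)
  then show ?thesis
    using xy by (auto simp: edges_def)
qed

section \<open>Extending correlations to the completion\<close>

lemma correlation_extends:
  assumes f: "f \<in> correlations G"
  shows "\<exists>g \<in> correlations H. \<forall>x \<in> elements G. g (Inl x) = Inl (f x)"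
proof -
  \<comment> \<open>The action of \<open>f\<close> on types. The element of type \<open>k\<close>
    picked by \<open>inv_into\<close> does not matter, as \<open>f\<close> respects equality of
    types.\<close>
  define \<pi> where "\<pi> k = type_of G (f (inv_into (elements G) (type_of G) k))" for k
  have \<pi>: "\<pi> (type_of G x) = type_of G (f x)" if "x \<in> elements G" for x
    unfolding \<pi>_def using that
    by (subst correlation_type[OF f]) (auto intro: inv_into_into f_inv_into_f)
  have \<pi>_inj: "\<pi> k = \<pi> l \<longleftrightarrow> k = l" if "k \<in> types G" "l \<in> types G" for k l
    using that \<pi> correlation_type[OF f] by (auto simp flip: type_surj)
  have \<pi>_closed: "\<pi> k \<in> types G" if "k \<in> types G" for k
    using that \<pi> correlation_closed[OF f] by (auto simp flip: type_surj)
  define g where "g = case_sum (Inl \<circ> f) (\<lambda>(e, k). Inr (f ` e, \<pi> k))"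
  have g_simps: "g (Inl x) = Inl (f x)" "g (Inr (e, k)) = Inr (f ` e, \<pi> k)" for x e k
    by (simp_all add: g_def)
  have g_block: "g u \<in> block G (f ` e)" if e: "e \<in> edges G" and u: "u \<in> block G e" for e u
  proof (cases u)
    case (Inr p)
    then obtain k where k: "u = Inr (e, k)" "k \<in> types G" "k \<notin> type_of G ` e"
      using u by (cases p) auto
    \<comment> \<open>By injectivity of \<pi>, the new type avoids the types of the ends of the
      image edge, as membership in its block requires.\<close>
    have "\<pi> k \<noteq> type_of G (f x)" if "x \<in> e" for x
    proof -
      have "x \<in> elements G"
        using that edge_subset[OF e] by blast
      then show ?thesis
        using \<pi>[of x] \<pi>_inj[of k "type_of G x"] k that type_surj by auto
    qed
    then show ?thesis
      using k \<pi>_closed by (auto simp: g_simps)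
  qed (use u in \<open>auto simp: g_simps\<close>)
  have g_inj: "inj_on g (elements H)"
  proof (rule inj_onI)
    fix u v assume uv: "u \<in> elements H" "v \<in> elements H" "g u = g v"
    have "f ` d = f ` e \<longleftrightarrow> d = e" if "d \<in> edges G" "e \<in> edges G" for d e
      using that inj_on_image_eq_iff[OF correlation_inj[OF f]] edge_subset by blast
    then show "u = v"
      using uv \<pi>_inj inj_on_eq_iff[OF correlation_inj[OF f]]
      by (cases u; cases v) (auto simp: g_def simp del: image_insert)
  qed
  have "restrict g (elements H) \<in> correlations H"
  proof (rule correlation_of_finite[OF finite_completion completion_incidence_subset])
    show "g ` elements H \<subseteq> elements H"
      using g_block correlation_edge[OF f] by (auto simp: completion_sel) blast
    show "inj_on g (elements H)"
      by (rule g_inj)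
    show "(g u, g v) \<in> incidence H" if uv: "(u, v) \<in> incidence H" for u v
    proof -
      obtain e where e: "u \<noteq> v" "e \<in> edges G" "u \<in> block G e" "v \<in> block G e"
        using uv by (auto simp: completion_sel)
      then have "g u \<noteq> g v"
        using g_inj uv completion_incidence_subset by (auto dest: inj_onD)
      then show ?thesis
        using e g_block correlation_edge[OF f] by (auto simp: completion_sel)
    qed
    \<comment> \<open>On old and new elements alike, \<open>g\<close> changes types by \<pi>, so
      equality of types is respected because \<pi> is injective on \<open>types G\<close>.\<close>
    have "type_of H (g u) = \<pi> (type_of H u)" if "u \<in> elements H" for u
      using that \<pi> by (cases u) (auto simp: g_def completion_sel(3,4))
    then show "type_of H (g u) = type_of H (g v) \<longleftrightarrow> type_of H u = type_of H v"
      if "u \<in> elements H" "v \<in> elements H" for u v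
      using that \<pi>_inj type_completion by simp
  qed
  then show ?thesis
    by (rule bexI[rotated]) (simp add: g_simps)
qed

lemma pair_iso_completion: "pair_iso H G"
proof (rule pair_iso_of_embedding[where \<iota> = Inl])
  show "f ` Inl ` elements G = Inl ` elements G" if f: "f \<in> correlations H" for f
  \<comment> \<open>On the finite set of old elements, injectivity turns invariance into
    equality.\<close>
  proof (rule endo_inj_surj)
    show "f ` Inl ` elements G \<subseteq> Inl ` elements G"
      using correlation_old_iff[OF f] by fastforce
    show "inj_on f (Inl ` elements G)"
      by (rule inj_on_subset[OF correlation_inj[OF f]]) auto
  qed (simp add: finite_elements)
  show "type_of H ` elements H \<subseteq> type_of G ` elements G"
    using type_completion type_surj by blast
qed (auto simp: completion_sel(3) correlation_determined correlation_extends)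

end

theorem theorem4p1:
  fixes \<Gamma> :: "('a, 'i) incidence_structure"
  assumes "incidence_system \<Gamma>"
    and "finite (elements \<Gamma>)"
    and "\<And>x. x \<in> elements \<Gamma> \<Longrightarrow> 2 \<le> degree \<Gamma> x"
    and "\<And>F. flag \<Gamma> F \<Longrightarrow> rank F \<le> 2"
  shows "\<exists>\<Gamma>' :: (nat, 'i) incidence_structure.
           incidence_geometry \<Gamma>' \<and> finite (elements \<Gamma>') \<and> types \<Gamma>' = types \<Gamma> \<and>
           (\<exists>\<phi> \<in> iso (Aut \<Gamma>') (Aut \<Gamma>). \<phi> ` Aut_I \<Gamma>' = Aut_I \<Gamma>)"
proof -
  interpret thick_triangle_free \<Gamma>
    by (intro thick_triangle_free.intro thick_triangle_free_axioms.intro) (fact assms)+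
  \<comment> \<open>The elements are to be natural numbers; as the completion is finite, an
    injective numbering exists.\<close>
  obtain h :: "'a + 'a set \<times> 'i \<Rightarrow> nat" where h: "inj_on h (elements H)"
    using finite_imp_inj_to_nat_seg[OF finite_completion] by blast
  have "pair_iso (relabel h H) \<Gamma>"
    using pair_iso_relabel[OF finite_completion completion_incidence_subset h]
      pair_iso_completion by (rule pair_iso_trans)
  moreover have "incidence_geometry (relabel h H)"
    using incidence_geometry_relabel[OF incidence_geometry_completion h] .
  moreover have "finite (elements (relabel h H))" "types (relabel h H) = types \<Gamma>"
    using finite_completion by (auto simp: relabel_def completion_sel(5))
  ultimately show ?thesis
    unfolding pair_iso_def by blast
qed

end
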